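(* Let $\varepsilon,q\in Q$ and suppose $L_W$ is an $\varepsilon$-fuzzy Lawvere Laplacian. If $\vec x=(x_v)_{v\in V}\in\mathcal S_q(L_W)$, then $$\underline F_{v\triangleleft e}x_v\preceq_{W(v,w)\cdot\varepsilon\cdot q}\underline F_{w\triangleleft e}x_w$$ for all edges $e$ and vertices $v,w$ with $v\triangleleft e\triangleright w$ (i.e. $\partial e=\{v,w\}$, both orderings).
   Context: Throughout, $\mathsf Q=(Q,\preceq,\cdot,1)$ is a commutative, unital, semicartesian quantale: $(Q,\preceq)$ is a complete lattice, $\cdot$ is an associative commutative operation with unit $1$ that distributes over arbitrary joins in each variable, and $p\cdot q\preceq p\wedge q$ (so $1=\top$). $[p,q]:=\bigvee\{r: p\cdot r\preceq q\}$. A (small) $\mathsf Q$-category $\mathsf C$ is a set $\mathrm{ob}(\mathsf C)$ with elements $\hom_{\mathsf C}(x,y)\in Q$ such that $\hom_{\mathsf C}(x,x)=1$ and $\hom_{\mathsf C}(x,y)\cdot\hom_{\mathsf C}(y,z)\preceq\hom_{\mathsf C}(x,z)$. A $\mathsf Q$-functor is a function $F$ on objects with $\hom_{\mathsf C}(x,y)\preceq\hom_{\mathsf D}(Fx,Fy)$. $x\preceq_q y$ means $\hom(x,y)\succeq q$; $x\approx_q y$ means $x\preceq_q y$ and $y\preceq_q x$. $Q$ itself is a $\mathsf Q$-category with $\hom(p,q)=[p,q]$. Given a set $\mathsf S$, $S:\mathsf S\to\mathrm{ob}(\mathsf C)$ and $W:\mathsf S\to Q$, the weighted meet $\bigwedge^W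 S$ is an object (unique up to $\approx_1$) with $\hom_{\mathsf C}(x,\bigwedge^W S)=\bigwedge_{c\in\mathsf S}[W(c),\hom_{\mathsf C}(x,S(c))]$ for all $x$; weighted joins satisfy $\hom_{\mathsf C}(\bigvee^W S,x)=\bigwedge_{c}[W(c),\hom_{\mathsf C}(S(c),x)]$. A $\mathsf Q$-category is a complete weighted lattice if it has all weighted meets and joins. $\mathsf Q$-functors $F:\mathsf C\to\mathsf D$, $G:\mathsf D\to\mathsf C$ are $q$-adjoint, $F\dashv_q G$, if $\hom_{\mathsf D}(Fx,y)\approx_q\hom_{\mathsf C}(x,Gy)$ (in $Q$) for all $x,y$. $G=(V,E)$ is a simple undirected graph; $\partial e$ is the set of endpoints of $e$; $N_v$ is the set of neighbors of $v$; $v\triangleleft e$ means $v\in\partial e$. $\underline F$ is a network sheaf and $\overline F$ a network cosheaf of complete weighted lattices agreeing on objects: for each $\sigma\in V\sqcup E$ a complete weighted lattice $F\sigma$, and for each $v\triangleleft e$ (arbitrary) $\mathsf Q$-functors $\underline F_{v\triangleleft e}:Fv\to Fe$ and $\overline F_{e\triangleright v}:Fe\to Fv$. $C^0F=\prod_{v\in V}Fv$ with $\hom_{C^0F}(\vec x,\vec y)=\bigwedge_v\hom_{Fv}(x_v,y_v)$. $W:V\times V\to Q$ is a weighting. The Lawvere Laplacian $L_W:\mathrm{ob}(C^0F)\to\mathrm{ob}(C^0F)$ is $$(L_W\vec x)_v=\bigwedge^{W(v,-)}_{w\in N_v,\ \partial e=\{v,w\}}\overline F_{e\triangleright v}\underline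 F_{w\triangleleft e}x_w$$ (with any choice of representatives of the weighted meets). $L_W$ is $\varepsilon$-fuzzy if $\underline F_{v\triangleleft e}\dashv_\varepsilon\overline F_{e\triangleright v}$ for every $v\triangleleft e$. $\mathcal S_q(L_W)$ is the full $\mathsf Q$-subcategory of $C^0F$ on the objects $\vec x$ with $\vec x\preceq_q L_W\vec x$. *)

theory Defs
  imports Main "HOL-Library.FuncSet"
begin

section \<open>Quantales\<close>

class semicartesian_quantale = complete_lattice + comm_monoid_mult +
  assumes mult_Sup_distrib: "p * Sup A = (SUP a\<in>A. p * a)"
    and mult_le_inf: "p * q \<le> inf p q"

definition residual :: "'q::semicartesian_quantale \<Rightarrow> 'q \<Rightarrow> 'q" where
  "residual p q = Sup {r. p * r \<le> q}"

section \<open>Categories enriched in a quantale\<close>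

record ('a, 'q) qcat =
  Ob :: "'a set"
  Hom :: "'a \<Rightarrow> 'a \<Rightarrow> 'q"

definition qcategory :: "('a, 'q::semicartesian_quantale) qcat \<Rightarrow> bool" where
  "qcategory C \<longleftrightarrow>
     (\<forall>x\<in>Ob C. Hom C x x = 1) \<and>
     (\<forall>x\<in>Ob C. \<forall>y\<in>Ob C. \<forall>z\<in>Ob C. Hom C x y * Hom C y z \<le> Hom C x z)"

definition qfunctor ::
  "('a, 'q::semicartesian_quantale) qcat \<Rightarrow> ('b, 'q) qcat \<Rightarrow> ('a \<Rightarrow> 'b) \<Rightarrow> bool" where
  "qfunctor C D f \<longleftrightarrow>
     f \<in> Ob C \<rightarrow> Ob D \<and> (\<forall>x\<in>Ob C. \<forall>y\<in>Ob C. Hom C x y \<le> Hom D (f x) (f y))"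

definition qbelow ::
  "('a, 'q::semicartesian_quantale) qcat \<Rightarrow> 'q \<Rightarrow> 'a \<Rightarrow> 'a \<Rightarrow> bool" where
  "qbelow C q x y \<longleftrightarrow> q \<le> Hom C x y"

definition qapprox ::
  "('a, 'q::semicartesian_quantale) qcat \<Rightarrow> 'q \<Rightarrow> 'a \<Rightarrow> 'a \<Rightarrow> bool" where
  "qapprox C q x y \<longleftrightarrow> qbelow C q x y \<and> qbelow C q y x"

definition quantale_qcat :: "('q::semicartesian_quantale, 'q) qcat" where
  "quantale_qcat = \<lparr>Ob = UNIV, Hom = residual\<rparr>"

definition qadjoint ::
  "'q::semicartesian_quantale \<Rightarrow> ('a, 'q) qcat \<Rightarrow> ('b, 'q) qcat
     \<Rightarrow> ('a \<Rightarrow> 'b) \<Rightarrow> ('b \<Rightarrow> 'a) \<Rightarrow> bool" where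
  "qadjoint q C D f g \<longleftrightarrow>
     qfunctor C D f \<and> qfunctor D C g \<and>
     (\<forall>x\<in>Ob C. \<forall>y\<in>Ob D. qapprox quantale_qcat q (Hom D (f x) y) (Hom C x (g y)))"

section \<open>Weighted meets and joins\<close>

text \<open>Weighted meets and joins are only unique up to isomorphism, hence relations.\<close>

definition is_weighted_meet ::
  "('a, 'q::semicartesian_quantale) qcat \<Rightarrow> 'i set \<Rightarrow> ('i \<Rightarrow> 'q) \<Rightarrow> ('i \<Rightarrow> 'a) \<Rightarrow> 'a \<Rightarrow> bool" where
  "is_weighted_meet C I W S m \<longleftrightarrow>
     m \<in> Ob C \<and> (\<forall>x\<in>Ob C. Hom C x m = (INF c\<in>I. residual (W c) (Hom C x (S c))))"

definition is_weighted_join ::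
  "('a, 'q::semicartesian_quantale) qcat \<Rightarrow> 'i set \<Rightarrow> ('i \<Rightarrow> 'q) \<Rightarrow> ('i \<Rightarrow> 'a) \<Rightarrow> 'a \<Rightarrow> bool" where
  "is_weighted_join C I W S m \<longleftrightarrow>
     m \<in> Ob C \<and> (\<forall>x\<in>Ob C. Hom C m x = (INF c\<in>I. residual (W c) (Hom C (S c) x)))"

text \<open>
  A definition cannot quantify over index types. Index sets in \<open>'a \<times> 'q\<close> suffice:
  a weighted diagram \<open>(S, W)\<close> over any index set has the same meets and joins as the
  diagram of the projections over its set of pairs \<open>(S c, W c)\<close>. This is proved in
  \<open>complete_weighted_lattice_meet\<close> and \<open>complete_weighted_lattice_join\<close>.
\<close>

definition complete_weighted_lattice :: "('a, 'q::semicartesian_quantale) qcat \<Rightarrow> bool" where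
  "complete_weighted_lattice C \<longleftrightarrow>
     qcategory C \<and>
     (\<forall>(I :: ('a \<times> 'q) set) W S. S \<in> I \<rightarrow> Ob C \<longrightarrow>
        (\<exists>m. is_weighted_meet C I W S m) \<and> (\<exists>j. is_weighted_join C I W S j))"

lemma complete_weighted_lattice_meet:
  fixes C :: "('a, 'q::semicartesian_quantale) qcat" and I :: "'i set"
  assumes C: "complete_weighted_lattice C" and S: "S \<in> I \<rightarrow> Ob C"
  shows "\<exists>m. is_weighted_meet C I W S m"
proof -
  let ?J = "(\<lambda>c. (S c, W c)) ` I"
  have "fst \<in> ?J \<rightarrow> Ob C"
    using S by auto
  then obtain m where "is_weighted_meet C ?J snd fst m"
    using C unfolding complete_weighted_lattice_def by blast
  then have "is_weighted_meet C I W S m"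
    by (simp add: is_weighted_meet_def image_image)
  then show ?thesis ..
qed

lemma complete_weighted_lattice_join:
  fixes C :: "('a, 'q::semicartesian_quantale) qcat" and I :: "'i set"
  assumes C: "complete_weighted_lattice C" and S: "S \<in> I \<rightarrow> Ob C"
  shows "\<exists>j. is_weighted_join C I W S j"
proof -
  let ?J = "(\<lambda>c. (S c, W c)) ` I"
  have "fst \<in> ?J \<rightarrow> Ob C"
    using S by auto
  then obtain j where "is_weighted_join C ?J snd fst j"
    using C unfolding complete_weighted_lattice_def by blast
  then have "is_weighted_join C I W S j"
    by (simp add: is_weighted_join_def image_image)
  then show ?thesis ..
qed

section \<open>Network sheaves and the Lawvere Laplacian\<close>

text \<open>
  An edge is identified with its set of endpoints, so \<open>v \<in> e\<close> is incidence. Graphs need not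
  be finite.
\<close>

definition simple_graph :: "'v set \<Rightarrow> 'v set set \<Rightarrow> bool" where
  "simple_graph V E \<longleftrightarrow> (\<forall>e\<in>E. e \<subseteq> V \<and> card e = 2)"

definition neighbors :: "'v set set \<Rightarrow> 'v \<Rightarrow> 'v set" where
  "neighbors E v = {w. {v, w} \<in> E}"

text \<open>
  The stalks of a network sheaf are a family indexed by the disjoint union of vertices and
  edges, with object sets in a common type \<open>'a\<close>. Restriction maps are written \<open>R v e\<close>
  (vertex to edge), corestriction maps \<open>K e v\<close> (edge to vertex).
\<close>

definition network_sheaf ::
  "'v set \<Rightarrow> 'v set set \<Rightarrow> ('v + 'v set \<Rightarrow> ('a, 'q::semicartesian_quantale) qcat)
     \<Rightarrow> ('v \<Rightarrow> 'v set \<Rightarrow> 'a \<Rightarrow> 'a) \<Rightarrow> bool" where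
  "network_sheaf V E F R \<longleftrightarrow>
     (\<forall>\<sigma>\<in>V <+> E. complete_weighted_lattice (F \<sigma>)) \<and>
     (\<forall>e\<in>E. \<forall>v\<in>e. qfunctor (F (Inl v)) (F (Inr e)) (R v e))"

definition network_cosheaf ::
  "'v set \<Rightarrow> 'v set set \<Rightarrow> ('v + 'v set \<Rightarrow> ('a, 'q::semicartesian_quantale) qcat)
     \<Rightarrow> ('v set \<Rightarrow> 'v \<Rightarrow> 'a \<Rightarrow> 'a) \<Rightarrow> bool" where
  "network_cosheaf V E F K \<longleftrightarrow>
     (\<forall>\<sigma>\<in>V <+> E. complete_weighted_lattice (F \<sigma>)) \<and>
     (\<forall>e\<in>E. \<forall>v\<in>e. qfunctor (F (Inr e)) (F (Inl v)) (K e v))"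

definition cochains0 ::
  "'v set \<Rightarrow> ('v + 'v set \<Rightarrow> ('a, 'q::semicartesian_quantale) qcat) \<Rightarrow> ('v \<Rightarrow> 'a, 'q) qcat" where
  "cochains0 V F =
     \<lparr>Ob = (\<Pi>\<^sub>E v\<in>V. Ob (F (Inl v))), Hom = (\<lambda>x y. INF v\<in>V. Hom (F (Inl v)) (x v) (y v))\<rparr>"

text \<open>
  \<open>L\<close> is a Lawvere Laplacian for some choice of representatives of the weighted meets.
  The choice may depend on the whole cochain \<open>x\<close>, not only on the diagram.
\<close>

definition lawvere_laplacian ::
  "'v set \<Rightarrow> 'v set set \<Rightarrow> ('v + 'v set \<Rightarrow> ('a, 'q::semicartesian_quantale) qcat)
     \<Rightarrow> ('v \<Rightarrow> 'v set \<Rightarrow> 'a \<Rightarrow> 'a) \<Rightarrow> ('v set \<Rightarrow> 'v \<Rightarrow> 'a \<Rightarrow> 'a) \<Rightarrow> ('v \<Rightarrow> 'v \<Rightarrow> 'q)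
     \<Rightarrow> (('v \<Rightarrow> 'a) \<Rightarrow> 'v \<Rightarrow> 'a) \<Rightarrow> bool" where
  "lawvere_laplacian V E F R K W L \<longleftrightarrow>
     L \<in> Ob (cochains0 V F) \<rightarrow> Ob (cochains0 V F) \<and>
     (\<forall>x\<in>Ob (cochains0 V F). \<forall>v\<in>V.
        is_weighted_meet (F (Inl v)) (neighbors E v) (W v)
          (\<lambda>w. K {v, w} v (R w {v, w} (x w))) (L x v))"

definition fuzzy ::
  "'v set set \<Rightarrow> ('v + 'v set \<Rightarrow> ('a, 'q::semicartesian_quantale) qcat)
     \<Rightarrow> ('v \<Rightarrow> 'v set \<Rightarrow> 'a \<Rightarrow> 'a) \<Rightarrow> ('v set \<Rightarrow> 'v \<Rightarrow> 'a \<Rightarrow> 'a) \<Rightarrow> 'q \<Rightarrow> bool" where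
  "fuzzy E F R K \<epsilon> \<longleftrightarrow>
     (\<forall>e\<in>E. \<forall>v\<in>e. qadjoint \<epsilon> (F (Inl v)) (F (Inr e)) (R v e) (K e v))"

definition suffix_subcategory ::
  "'v set \<Rightarrow> ('v + 'v set \<Rightarrow> ('a, 'q::semicartesian_quantale) qcat)
     \<Rightarrow> (('v \<Rightarrow> 'a) \<Rightarrow> 'v \<Rightarrow> 'a) \<Rightarrow> 'q \<Rightarrow> ('v \<Rightarrow> 'a, 'q) qcat" where
  "suffix_subcategory V F L q =
     \<lparr>Ob = {x \<in> Ob (cochains0 V F). qbelow (cochains0 V F) q x (L x)},
      Hom = Hom (cochains0 V F)\<rparr>"

end

theory Submission
  imports Defs
begin

text \<open>The argument is local to one edge \<open>e = {v, w}\<close>. Being a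
  \<open>q\<close>-suffix point bounds the hom from \<open>x v\<close> to \<open>L x v\<close> below
  by \<open>q\<close>. As \<open>L x v\<close> is a weighted meet with \<open>w\<close> among its
  indices, \<open>weighted_meet_le\<close> passes to the component
  \<open>K e v (R w e (x w))\<close> at the price of a factor \<open>W v w\<close>. Transposing
  along the \<epsilon>-adjunction of \<open>R v e\<close> and \<open>K e v\<close>, by
  \<open>qadjoint_transpose_le\<close>, moves the comparison into the edge stalk and costs a further
  factor \<epsilon>. Both prices are read off from residuation,
  \<open>le_residual_iff\<close>.\<close>

lemma quantale_mult_right_mono:
  fixes a b p :: "'q::semicartesian_quantale"
  assumes "a \<le> b"
  shows "p * a \<le> p * b"
proof -
  \<comment> \<open>Since \<open>a \<le> b\<close>, \<open>b\<close> is the join of the pair, so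
    monotonicity is an instance of distributivity over joins.\<close>
  have "p * b = p * Sup {a, b}"
    using assms by (simp add: sup_absorb2)
  also have "\<dots> = sup (p * a) (p * b)"
    by (subst mult_Sup_distrib) simp
  finally show ?thesis
    by (metis sup.cobounded1)
qed

text \<open>Distributivity makes the supremum defining \<open>residual p q\<close> itself satisfy
  the inequality it ranges over, so multiplication by \<open>p\<close> is left adjoint to
  \<open>residual p\<close>.\<close>

lemma le_residual_iff:
  fixes p q r :: "'q::semicartesian_quantale"
  shows "r \<le> residual p q \<longleftrightarrow> p * r \<le> q"
proof
  assume "r \<le> residual p q"
  then have "p * r \<le> p * residual p q"
    by (rule quantale_mult_right_mono)
  also have "\<dots> \<le> q"
    unfolding residual_def mult_Sup_distrib by (auto intro: SUP_least)
  finally show "p * r \<le> q" .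
qed (auto simp: residual_def intro: Sup_upper)

lemma weighted_meet_le:
  assumes "is_weighted_meet C I W S m" and "y \<in> Ob C" and "c \<in> I"
  shows "W c * Hom C y m \<le> Hom C y (S c)"
proof -
  have "Hom C y m \<le> residual (W c) (Hom C y (S c))"
    using assms by (auto simp: is_weighted_meet_def intro: INF_lower)
  then show ?thesis
    by (simp add: le_residual_iff)
qed

text \<open>Approximate equality of the two homs inside the quantale bounds a residual below by
  \<open>q\<close>; residuation turns this into a transposition with loss \<open>q\<close>.\<close>

lemma qadjoint_transpose_le:
  assumes "qadjoint q C D f g" and "x \<in> Ob C" and "y \<in> Ob D"
  shows "Hom C x (g y) * q \<le> Hom D (f x) y"
  using assms
  by (simp add: qadjoint_def qapprox_def qbelow_def quantale_qcat_def le_residual_iff)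

theorem lemma3p15:
  fixes V :: "'v set" and E :: "'v set set"
    and F :: "'v + 'v set \<Rightarrow> ('a, 'q::semicartesian_quantale) qcat"
    and R :: "'v \<Rightarrow> 'v set \<Rightarrow> 'a \<Rightarrow> 'a" and K :: "'v set \<Rightarrow> 'v \<Rightarrow> 'a \<Rightarrow> 'a"
    and W :: "'v \<Rightarrow> 'v \<Rightarrow> 'q" and L :: "('v \<Rightarrow> 'a) \<Rightarrow> 'v \<Rightarrow> 'a"
    and \<epsilon> q :: 'q and x :: "'v \<Rightarrow> 'a"
  assumes "simple_graph V E"
    and "network_sheaf V E F R"
    and "network_cosheaf V E F K"
    and "lawvere_laplacian V E F R K W L"
    and "fuzzy E F R K \<epsilon>"
    and "x \<in> Ob (suffix_subcategory V F L q)"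
  shows "\<forall>e\<in>E. \<forall>v w. e = {v, w} \<longrightarrow>
           qbelow (F (Inr e)) (W v w * \<epsilon> * q) (R v e (x v)) (R w e (x w))"
proof (intro ballI allI impI)
  fix e v w
  assume e: "e \<in> E" and e_eq: "e = {v, w}"
  let ?Fv = "F (Inl v)" and ?Fe = "F (Inr e)"
  have v: "v \<in> V" and w: "w \<in> V"
    using assms(1) e e_eq by (auto simp: simple_graph_def)
  have x: "x \<in> Ob (cochains0 V F)" and q: "q \<le> Hom (cochains0 V F) x (L x)"
    using assms(6) by (auto simp: suffix_subcategory_def qbelow_def)
  have xv: "x v \<in> Ob ?Fv" and xw: "x w \<in> Ob (F (Inl w))"
    using x v w by (auto simp: cochains0_def)
  have Rw: "R w e (x w) \<in> Ob ?Fe"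
    using assms(2) e e_eq xw by (auto simp: network_sheaf_def qfunctor_def)
  have "is_weighted_meet ?Fv (neighbors E v) (W v) (\<lambda>w. K {v, w} v (R w {v, w} (x w))) (L x v)"
    using assms(4) x v by (simp add: lawvere_laplacian_def)
  from weighted_meet_le[OF this xv, of w]
  have meet: "W v w * Hom ?Fv (x v) (L x v) \<le> Hom ?Fv (x v) (K e v (R w e (x w)))"
    using e e_eq by (simp add: neighbors_def)
  \<comment> \<open>Homs of cochains are infima over the vertices, so the bound holds at each
    vertex.\<close>
  have "q \<le> Hom ?Fv (x v) (L x v)"
    using q v by (auto simp: cochains0_def le_INF_iff)
  then have "W v w * q \<le> Hom ?Fv (x v) (K e v (R w e (x w)))"
    using meet quantale_mult_right_mono order_trans by blast
  then have "\<epsilon> * (W v w * q) \<le> \<epsilon> * Hom ?Fv (x v) (K e v (R w e (x w)))"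
    by (rule quantale_mult_right_mono)
  \<comment> \<open>Transpose at the endpoint \<open>v\<close>, with the restriction from the other
    endpoint \<open>w\<close> as the object of the edge stalk.\<close>
  also have "\<dots> \<le> Hom ?Fe (R v e (x v)) (R w e (x w))"
  proof -
    have "qadjoint \<epsilon> ?Fv ?Fe (R v e) (K e v)"
      using assms(5) e e_eq by (simp add: fuzzy_def)
    from qadjoint_transpose_le[OF this xv Rw] show ?thesis
      by (simp add: mult.commute)
  qed
  finally show "qbelow ?Fe (W v w * \<epsilon> * q) (R v e (x v)) (R w e (x w))"
    by (simp add: qbelow_def mult.assoc mult.left_commute)
qed

end
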